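(* Let $\alpha\in(0,1)$, $\theta>0$, $\lambda_1,\lambda_2>0$, $\Lambda=\lambda_1+\lambda_2$. Let $L$ be a random threshold with values in $\mathbb N=\{1,2,\dots\}$ and $\overline q_k=\mathbb P(L>k)$ for $k\in\mathbb N_0$, independent of the bivariate tempered space-fractional Poisson process $\mathcal Q^{\alpha,\theta}$ with parameters $\alpha,\theta,\lambda_1,\lambda_2$. Let $\mathcal Z(t)$ be the sum of the two components of $\mathcal Q^{\alpha,\theta}(t)$ and let $T=\inf\{t\ge0:\mathcal Z(t)=L\}$ be the failure time of the system. Then the reliability function $\overline R_T(t)=\mathbb P\{T>t\}$ of $T$ is given by $$\overline R_T(t)=\sum_{k=0}^\infty\overline q_k\,\frac{(-1)^k}{k!}\,e^{t\theta^\alpha}\sum_{i=0}^\infty\frac{\theta^i}{\Lambda^i\,i!}\;{}_1\psi_1\!\left[-\Lambda^\alpha t\ \Big|\ \begin{matrix}(1,\alpha)\\(1-k-i,\alpha)\end{matrix}\right],\qquad t\ge0.$$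
   Context: The tempered $\alpha$-stable subordinator $\{S^{\alpha,\theta}(t)\}_{t\ge0}$ is the Lévy subordinator with $\mathbb E[e^{-uS^{\alpha,\theta}(t)}]=e^{-t((u+\theta)^\alpha-\theta^\alpha)}$, $u\ge0$. Let $\{\mathcal N_i(t,\lambda_i)\}_{t\ge0}$, $i=1,2$, be independent homogeneous Poisson processes with rates $\lambda_i$, independent of $S^{\alpha,\theta}$. The bivariate tempered space-fractional Poisson process is $\mathcal Q^{\alpha,\theta}(t)=(\mathcal N_1(S^{\alpha,\theta}(t),\lambda_1),\mathcal N_2(S^{\alpha,\theta}(t),\lambda_2))$, so $\mathcal Z(t)=\mathcal N_1(S^{\alpha,\theta}(t),\lambda_1)+\mathcal N_2(S^{\alpha,\theta}(t),\lambda_2)$ is the total number of shocks (of types 1 and 2) in $[0,t]$. In the model the reliability function is expressed as $\overline R_T(t)=\sum_{k=0}^\infty\overline q_k\sum_{k_1+k_2=k}\mathbb P\{\mathcal Q^{\alpha,\theta}(t)=(k_1,k_2)\}$, with $\overline q_0=1$. The generalized Wright function used here is ${}_1\psi_1\!\left[z\,\Big|\,\begin{matrix}(a,b)\\(c,d)\end{matrix}\right]=\sum_{m=0}^\infty\frac{z^m}{m!}\frac{\Gamma(a+bm)}{\Gamma(c+dm)}$ (under the convergence condition $d-b>-1$), with the usual convention $1/\Gamma(x)=0$ for $x\in\{0,-1,-2,\dots\}$.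
   Formalization: T is taken as inf{t≥0: Z(t)≥L}, since Z can jump over L and the formula fails with "="; the formula is claimed when the series over i converge for every k, which is proved for θ<Λ (for t>0 and θ≥Λ some of them diverge). *)

theory Defs
  imports "HOL-Probability.Probability"
begin

section \<open>Processes indexed by nonnegative reals\<close>

text \<open>
  A process is a function \<open>X :: real \<Rightarrow> 'a \<Rightarrow> 'b\<close> on the sample space of \<open>M\<close>, of which only the
  times \<open>t \<ge> 0\<close> are relevant. The sigma-algebra generated by \<open>(X t)\<^sub>t\<^sub>\<ge>\<^sub>0\<close> is the one pulled back
  along the path map. Independence is phrased with these sigma-algebras because the library's
  \<open>indep_var\<close> needs random variables of equal type.
\<close>

definition path_events :: "'a measure \<Rightarrow> 'b measure \<Rightarrow> (real \<Rightarrow> 'a \<Rightarrow> 'b) \<Rightarrow> 'a set set" where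
  "path_events M E X =
     sets (vimage_algebra (space M) (\<lambda>\<omega>. \<lambda>t\<in>{0..}. X t \<omega>) (Pi\<^sub>M {0..} (\<lambda>_. E)))"

definition cadlag :: "(real \<Rightarrow> real) \<Rightarrow> bool" where
  "cadlag x \<longleftrightarrow> (\<forall>t\<ge>0. continuous (at_right t) x) \<and> (\<forall>t>0. \<exists>l. (x \<longlongrightarrow> l) (at_left t))"

definition independent_increments :: "'a measure \<Rightarrow> (real \<Rightarrow> 'a \<Rightarrow> real) \<Rightarrow> bool" where
  "independent_increments M X \<longleftrightarrow>
     (\<forall>(n::nat) s. 0 \<le> s 0 \<and> (\<forall>j<n. s j \<le> s (Suc j)) \<longrightarrow>
        prob_space.indep_vars M (\<lambda>_. borel) (\<lambda>j \<omega>. X (s (Suc j)) \<omega> - X (s j) \<omega>) {..<n})"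

definition stationary_increments :: "'a measure \<Rightarrow> (real \<Rightarrow> 'a \<Rightarrow> real) \<Rightarrow> bool" where
  "stationary_increments M X \<longleftrightarrow>
     (\<forall>s\<ge>0. \<forall>h\<ge>0. distr M borel (\<lambda>\<omega>. X (s + h) \<omega> - X s \<omega>) = distr M borel (X h))"

text \<open>
  Path properties are required of every path, not only of almost every one: the usual choice of a
  regular version, which makes subordinated processes and hitting times measurable without
  completing \<open>M\<close>.
\<close>

definition levy_process :: "'a measure \<Rightarrow> (real \<Rightarrow> 'a \<Rightarrow> real) \<Rightarrow> bool" where
  "levy_process M X \<longleftrightarrow>
     (\<forall>t\<ge>0. X t \<in> borel_measurable M) \<and>
     (\<forall>\<omega>\<in>space M. X 0 \<omega> = 0) \<and>
     independent_increments M X \<and>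
     stationary_increments M X \<and>
     (\<forall>\<omega>\<in>space M. cadlag (\<lambda>t. X t \<omega>))"

definition levy_subordinator :: "'a measure \<Rightarrow> (real \<Rightarrow> 'a \<Rightarrow> real) \<Rightarrow> bool" where
  "levy_subordinator M S \<longleftrightarrow>
     levy_process M S \<and> (\<forall>\<omega>\<in>space M. mono_on {0..} (\<lambda>t. S t \<omega>))"

definition tempered_stable_subordinator ::
    "'a measure \<Rightarrow> real \<Rightarrow> real \<Rightarrow> (real \<Rightarrow> 'a \<Rightarrow> real) \<Rightarrow> bool" where
  "tempered_stable_subordinator M \<alpha> \<theta> S \<longleftrightarrow>
     levy_subordinator M S \<and>
     (\<forall>t\<ge>0. \<forall>u\<ge>0. (\<integral>\<omega>. exp (- u * S t \<omega>) \<partial>M) = exp (- t * ((u + \<theta>) powr \<alpha> - \<theta> powr \<alpha>)))"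

definition poisson_process :: "'a measure \<Rightarrow> real \<Rightarrow> (real \<Rightarrow> 'a \<Rightarrow> nat) \<Rightarrow> bool" where
  "poisson_process M rate N \<longleftrightarrow>
     levy_process M (\<lambda>t \<omega>. real (N t \<omega>)) \<and>
     (\<forall>\<omega>\<in>space M. mono_on {0..} (\<lambda>t. N t \<omega>)) \<and>
     (\<forall>t>0. distr M (count_space UNIV) (N t) = measure_pmf (poisson_pmf (rate * t)))"


section \<open>The shock model\<close>

definition subordinated_pair ::
    "(real \<Rightarrow> 'a \<Rightarrow> nat) \<Rightarrow> (real \<Rightarrow> 'a \<Rightarrow> nat) \<Rightarrow> (real \<Rightarrow> 'a \<Rightarrow> real) \<Rightarrow> real \<Rightarrow> 'a \<Rightarrow> nat \<times> nat" where
  "subordinated_pair N1 N2 S t \<omega> = (N1 (S t \<omega>) \<omega>, N2 (S t \<omega>) \<omega>)"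

definition bivariate_tsfpp ::
    "'a measure \<Rightarrow> real \<Rightarrow> real \<Rightarrow> real \<Rightarrow> real \<Rightarrow>
     (real \<Rightarrow> 'a \<Rightarrow> real) \<Rightarrow> (real \<Rightarrow> 'a \<Rightarrow> nat) \<Rightarrow> (real \<Rightarrow> 'a \<Rightarrow> nat) \<Rightarrow>
     (real \<Rightarrow> 'a \<Rightarrow> nat \<times> nat) \<Rightarrow> bool" where
  "bivariate_tsfpp M \<alpha> \<theta> rate1 rate2 S N1 N2 Q \<longleftrightarrow>
     tempered_stable_subordinator M \<alpha> \<theta> S \<and>
     poisson_process M rate1 N1 \<and>
     poisson_process M rate2 N2 \<and>
     prob_space.indep_sets M
       ((!) [path_events M borel S,
             path_events M (count_space UNIV) N1,
             path_events M (count_space UNIV) N2]) {..<3::nat} \<and>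
     Q = subordinated_pair N1 N2 S"

definition total_shocks :: "(real \<Rightarrow> 'a \<Rightarrow> nat \<times> nat) \<Rightarrow> real \<Rightarrow> 'a \<Rightarrow> nat" where
  "total_shocks Q t \<omega> = fst (Q t \<omega>) + snd (Q t \<omega>)"

text \<open>
  The subordinated counting process has jumps larger than one with positive probability, so it may
  jump over \<open>L\<close> without taking the value \<open>L\<close>. The system fails at the first time at which the number
  of shocks has reached the threshold, hence \<open>\<ge>\<close> rather than \<open>=\<close>: only then is
  P(T > t) = P(Z(t) < L) = SUM k. P(L > k) P(Z(t) = k). The infimum of the empty set is \<open>\<infinity>\<close>.
\<close>

definition failure_time :: "(real \<Rightarrow> 'a \<Rightarrow> nat \<times> nat) \<Rightarrow> ('a \<Rightarrow> nat) \<Rightarrow> 'a \<Rightarrow> ereal" where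
  "failure_time Q L \<omega> = Inf (ereal ` {t. 0 \<le> t \<and> total_shocks Q t \<omega> \<ge> L \<omega>})"

definition reliability :: "'a measure \<Rightarrow> ('a \<Rightarrow> ereal) \<Rightarrow> real \<Rightarrow> real" where
  "reliability M T t = measure M {\<omega> \<in> space M. T \<omega> > ereal t}"


section \<open>The generalized Wright function\<close>

text \<open>
  \<open>rGamma\<close> is the entire function 1 / Gamma, which vanishes at the poles 0, -1, -2, ... of Gamma. The series
  converges absolutely for all \<open>z\<close> if \<open>d - b > -1\<close> and no \<open>a + b * m\<close> is a pole of \<open>Gamma\<close>.
\<close>

definition wright_psi11 :: "real \<Rightarrow> real \<Rightarrow> real \<Rightarrow> real \<Rightarrow> real \<Rightarrow> real" where
  "wright_psi11 a b c d z =
     (\<Sum>m. z ^ m / fact m * (Gamma (a + b * real m) * rGamma (c + d * real m)))"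

end

theory Submission
  imports Defs "HOL-Real_Asymp.Real_Asymp"
begin

text \<open>
  Write \<open>G\<^sub>n\<close> for the \<open>n\<close>-th derivative of \<open>G(x) = exp (- t * x powr \<alpha>)\<close>. Differentiating the series
  of \<open>G\<close> termwise shows that the Wright function with parameter \<open>1 - k - i\<close> at \<open>- \<Lambda>\<^sup>\<alpha> t\<close> is
  \<open>\<Lambda> ^ (k + i) * G\<^sub>k\<^sub>+\<^sub>i(\<Lambda>)\<close>, so the inner sum is \<open>\<Lambda> ^ k\<close> times the Taylor series of \<open>G\<^sub>k\<close> about \<open>\<Lambda>\<close>,
  evaluated at \<open>\<Lambda> + \<theta>\<close>. Its radius of convergence is \<open>\<Lambda>\<close>, because the derivative of \<open>G\<close> blows up at \<open>0\<close>
  when \<open>t > 0\<close>; in the boundary case \<open>\<theta> = \<Lambda>\<close> Abel's theorem identifies the sum.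

  On the probabilistic side, \<open>Z(t)\<close> is a Poisson mixture with random mean \<open>\<Lambda> * S(t)\<close>. Its generating
  function at \<open>s\<close> is the Laplace transform of \<open>S(t)\<close> at \<open>\<Lambda> * (1 - s)\<close>, that is
  \<open>exp (t * \<theta> powr \<alpha>) * G(\<Lambda> + \<theta> - \<Lambda> * s)\<close>; comparing power series coefficients gives
  \<open>P(Z(t) = k) = exp (t * \<theta> powr \<alpha>) * (- \<Lambda>) ^ k / k! * G\<^sub>k(\<Lambda> + \<theta>)\<close>.
\<close>

section \<open>Derivatives of the stretched exponential function\<close>

text \<open>For a >= 0 each factor satisfies |a - i| <= a + i, and the product of the a + i is the
  numerator of the binomial coefficient of -a up to the sign (-1)^n. The resulting majorant can
  itself be summed by the binomial series.\<close>

lemma abs_gbinomial_le_minus: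
  fixes a :: real
  assumes "0 \<le> a"
  shows "\<bar>a gchoose n\<bar> \<le> (- 1) ^ n * (- a gchoose n)"
proof -
  have "\<bar>\<Prod>i = 0..<n. a - real i\<bar> \<le> (\<Prod>i = 0..<n. a + real i)"
    unfolding abs_prod using assms by (intro prod_mono) auto
  also have "\<dots> = (\<Prod>i = 0..<n. - 1 * (- a - real i))"
    by (intro prod.cong) auto
  also have "\<dots> = (- 1) ^ n * (\<Prod>i = 0..<n. - a - real i)"
    unfolding prod.distrib by simp
  finally show ?thesis
    by (simp add: gbinomial_prod_rev abs_divide divide_right_mono)
qed

text \<open>Fubini for double series: absolute summability turns the iterated sum over rows into an
  unordered sum over pairs, which can be read column by column. The detour through
  \<open>has_sum\<close> is made because \<open>sums\<close> fixes an order of summation.\<close>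

lemma abs_summable_double_sums:
  fixes f :: "nat \<times> nat \<Rightarrow> real"
  assumes f: "(\<lambda>p. norm (f p)) summable_on UNIV"
    and rows: "\<And>m. (\<lambda>i. f (m, i)) sums g m"
    and g: "g sums s"
  shows "summable (\<lambda>m. f (m, i))" and "(\<lambda>i. \<Sum>m. f (m, i)) sums s"
proof -
  have sf: "f summable_on UNIV"
    using f by (rule Infinite_Sum.abs_summable_summable)
  then obtain s' where s': "(f has_sum s') (UNIV \<times> UNIV)"
    by (auto simp: summable_on_def)
  have row: "((\<lambda>i. f (m, i)) has_sum g m) UNIV" for m
  proof -
    have "(\<lambda>i. f (m, i)) summable_on UNIV"
      using summable_on_SigmaD1[of "\<lambda>x y. f (x, y)" UNIV "\<lambda>_. UNIV" m] sf by (simp add: case_prod_beta)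
    with rows[of m] show ?thesis
      by (metis has_sum_imp_sums has_sum_infsum sums_unique2)
  qed
  have "(g has_sum s') UNIV"
    using has_sum_SigmaD[OF s'] row by auto
  with g have "s' = s"
    by (metis has_sum_imp_sums sums_unique2)
  have sw: "((\<lambda>(i, m). f (m, i)) has_sum s) (UNIV \<times> UNIV)"
    using s' \<open>s' = s\<close> has_sum_swap[of f UNIV UNIV s] by auto
  have col: "((\<lambda>m. f (m, i)) has_sum (\<Sum>m. f (m, i))) UNIV" for i
  proof -
    have "(\<lambda>m. f (m, i)) summable_on UNIV"
      using summable_on_SigmaD1[of "\<lambda>x y. f (y, x)" UNIV "\<lambda>_. UNIV" i] sw
      by (auto simp: summable_on_def)
    then show ?thesis
      by (metis has_sum_imp_sums has_sum_infsum sums_unique)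
  qed
  show "summable (\<lambda>m. f (m, i))"
    using col has_sum_imp_sums by (blast intro: sums_summable)
  show "(\<lambda>i. \<Sum>m. f (m, i)) sums s"
    using has_sum_SigmaD[OF sw] col by (auto intro: has_sum_imp_sums)
qed

text \<open>For x > 0 this is the n-th derivative of \<open>exp (- t * x powr \<alpha>)\<close>,
  with the exponential series differentiated termwise: \<open>fact n\<close> times the binomial
  coefficient is the falling factorial produced by n differentiations of a power. The series form
  allows comparison with the Wright function; the derivative property is
  \<open>has_real_derivative_stretched_exp_deriv\<close>.\<close>

definition stretched_exp_deriv :: "real \<Rightarrow> real \<Rightarrow> nat \<Rightarrow> real \<Rightarrow> real" where
  "stretched_exp_deriv \<alpha> t n x =
     fact n * (\<Sum>m. (- t) ^ m / fact m * (\<alpha> * real m gchoose n) * x powr (\<alpha> * real m - real n))"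

section \<open>Taylor expansions of the stretched exponential function and its derivatives\<close>

lemma stretched_exp_sums:
  assumes "0 < x"
  shows "(\<lambda>m. (- t) ^ m / fact m * x powr (\<alpha> * real m)) sums exp (- t * x powr \<alpha>)"
proof -
  have "x powr (\<alpha> * real m) = (x powr \<alpha>) ^ m" for m
    using assms by (simp add: powr_powr[symmetric] powr_realpow)
  then show ?thesis
    using exp_converges[of "- t * x powr \<alpha>"] unfolding power_mult_distrib
    by (simp add: field_simps)
qed

lemma stretched_exp_deriv_0:
  assumes "0 < x"
  shows "stretched_exp_deriv \<alpha> t 0 x = exp (- t * x powr \<alpha>)"
  using stretched_exp_sums[OF assms] by (simp add: stretched_exp_deriv_def sums_iff)

text \<open>
  Expand every power \<open>(x + y) powr (\<alpha> * m)\<close> by the binomial series and swap the two sums. The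
  absolute double series is dominated by the one with exponents \<open>- \<alpha> * m\<close>, whose
  binomial coefficients alternate in sign.
\<close>

lemma stretched_exp_taylor_0:
  assumes \<alpha>: "0 < \<alpha>" and y: "\<bar>y\<bar> < x" "y \<noteq> 0"
  shows "summable (\<lambda>m. (- t) ^ m / fact m * (\<alpha> * real m gchoose i) * x powr (\<alpha> * real m - real i))"
    and "(\<lambda>i. stretched_exp_deriv \<alpha> t i x / fact i * y ^ i) sums exp (- t * (x + y) powr \<alpha>)"
proof -
  have x: "0 < x" using y by linarith
  define f :: "nat \<times> nat \<Rightarrow> real" where
    "f = (\<lambda>(m, i). (- t) ^ m / fact m * ((\<alpha> * real m gchoose i) * y ^ i * x powr (\<alpha> * real m - real i)))"
  define h :: "nat \<times> nat \<Rightarrow> real" where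
    "h = (\<lambda>(m, i). \<bar>t\<bar> ^ m / fact m * ((- 1) ^ i * (- (\<alpha> * real m) gchoose i) * \<bar>y\<bar> ^ i
                      * x powr (\<alpha> * real m - real i)))"
  have h0: "0 \<le> h p" for p
  proof (cases p)
    case (Pair m i)
    have "0 \<le> (- 1) ^ i * (- (\<alpha> * real m) gchoose i)"
      using abs_gbinomial_le_minus[of "\<alpha> * real m" i] \<alpha> by (simp add: order_trans[OF abs_ge_zero])
    then show ?thesis
      unfolding Pair h_def prod.case by (intro mult_nonneg_nonneg[OF _ mult_nonneg_nonneg[OF mult_nonneg_nonneg]]) auto
  qed
  have fh: "norm (f p) \<le> h p" for p
  proof (cases p)
    case (Pair m i)
    define b where "b = (- 1) ^ i * (- (\<alpha> * real m) gchoose i)"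
    have "\<bar>\<alpha> * real m gchoose i\<bar> \<le> b"
      unfolding b_def by (rule abs_gbinomial_le_minus) (use \<alpha> in simp)
    then show ?thesis
      unfolding Pair h_def f_def prod.case real_norm_def abs_mult b_def[symmetric]
      by (intro mult_mono mult_nonneg_nonneg) (auto simp: power_abs)
  qed
  \<comment> \<open>Row m of \<open>h\<close> is |t|^m / m! times the binomial series of x^(\<alpha>
    m) * (1 - |y| / x)^(-\<alpha> m). Clearing the denominator x turns this power into
    \<open>r ^ m\<close>.\<close>
  define r where "r = x powr (2 * \<alpha>) * (x - \<bar>y\<bar>) powr (- \<alpha>)"
  have hrow: "((\<lambda>i. h (m, i)) has_sum ((\<bar>t\<bar> * r) ^ m / fact m)) UNIV" for m
  proof (rule sums_nonneg_imp_has_sum[OF _ h0])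
    have "(\<lambda>i. \<bar>t\<bar> ^ m / fact m * x powr (2 * (\<alpha> * real m)) *
             ((- (\<alpha> * real m) gchoose i) * (- \<bar>y\<bar>) ^ i * x powr (- (\<alpha> * real m) - real i)))
          sums (\<bar>t\<bar> ^ m / fact m * x powr (2 * (\<alpha> * real m)) * (- \<bar>y\<bar> + x) powr (- (\<alpha> * real m)))"
      by (intro sums_mult gen_binomial_real') (use y in auto)
    also have "(\<lambda>i. \<bar>t\<bar> ^ m / fact m * x powr (2 * (\<alpha> * real m)) *
             ((- (\<alpha> * real m) gchoose i) * (- \<bar>y\<bar>) ^ i * x powr (- (\<alpha> * real m) - real i))) = (\<lambda>i. h (m, i))"
    proof
      fix i
      have "x powr (\<alpha> * real m - real i) = x powr (2 * (\<alpha> * real m)) * x powr (- (\<alpha> * real m) - real i)"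
        by (simp add: powr_add[symmetric])
      then show "\<bar>t\<bar> ^ m / fact m * x powr (2 * (\<alpha> * real m)) *
             ((- (\<alpha> * real m) gchoose i) * (- \<bar>y\<bar>) ^ i * x powr (- (\<alpha> * real m) - real i)) = h (m, i)"
        by (simp add: h_def power_minus[of "\<bar>y\<bar>"])
    qed
    also have "\<bar>t\<bar> ^ m / fact m * x powr (2 * (\<alpha> * real m)) * (- \<bar>y\<bar> + x) powr (- (\<alpha> * real m))
        = (\<bar>t\<bar> * r) ^ m / fact m"
    proof -
      have "x powr (2 * (\<alpha> * real m)) = (x powr (2 * \<alpha>)) ^ m"
        using x by (simp add: powr_powr[symmetric] powr_realpow mult.assoc[symmetric])
      moreover have "(- \<bar>y\<bar> + x) powr (- (\<alpha> * real m)) = ((x - \<bar>y\<bar>) powr (- \<alpha>)) ^ m"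
      proof -
        have "(- \<bar>y\<bar> + x) powr (- (\<alpha> * real m)) = ((x - \<bar>y\<bar>) powr (- \<alpha>)) powr real m"
          by (simp add: powr_powr)
        then show ?thesis using y by (simp add: powr_realpow)
      qed
      ultimately show ?thesis by (simp add: r_def power_mult_distrib)
    qed
    finally show "(\<lambda>i. h (m, i)) sums ((\<bar>t\<bar> * r) ^ m / fact m)" .
  qed
  have "(\<lambda>m. (\<bar>t\<bar> * r) ^ m / fact m) sums exp (\<bar>t\<bar> * r)"
    using exp_converges[of "\<bar>t\<bar> * r"] by (simp add: field_simps)
  then have "((\<lambda>m. (\<bar>t\<bar> * r) ^ m / fact m) has_sum exp (\<bar>t\<bar> * r)) UNIV"
    by (rule sums_nonneg_imp_has_sum) (simp add: r_def)
  then have "(\<lambda>m. (\<bar>t\<bar> * r) ^ m / fact m) summable_on UNIV"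
    by (auto simp: summable_on_def)
  then have "h summable_on UNIV \<times> UNIV"
    by (rule summable_on_SigmaI[OF hrow]) (rule h0)
  then have "(\<lambda>p. norm (f p)) summable_on UNIV"
    using fh by (intro Infinite_Sum.abs_summable_on_comparison_test') auto
  moreover have "(\<lambda>i. f (m, i)) sums ((- t) ^ m / fact m * (x + y) powr (\<alpha> * real m))" for m
    unfolding f_def prod.case
    by (intro sums_mult gen_binomial_real'[of y x "\<alpha> * real m", unfolded add.commute[of y]] y)
  moreover have "(\<lambda>m. (- t) ^ m / fact m * (x + y) powr (\<alpha> * real m)) sums exp (- t * (x + y) powr \<alpha>)"
    by (rule stretched_exp_sums) (use y in linarith)
  ultimately have sm: "summable (\<lambda>m. f (m, i))"
    and *: "(\<lambda>i. \<Sum>m. f (m, i)) sums exp (- t * (x + y) powr \<alpha>)" for i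
    by (rule abs_summable_double_sums)+
  have f_eq: "(\<lambda>m. f (m, i)) =
      (\<lambda>m. y ^ i * ((- t) ^ m / fact m * (\<alpha> * real m gchoose i) * x powr (\<alpha> * real m - real i)))" for i
    by (simp add: f_def fun_eq_iff)
  \<comment> \<open>The factor \<open>y ^ i\<close> can be divided out because y is nonzero.\<close>
  show sm': "summable (\<lambda>m. (- t) ^ m / fact m * (\<alpha> * real m gchoose i) * x powr (\<alpha> * real m - real i))" for i
    using sm[of i] y(2) unfolding f_eq summable_cmult_iff by simp
  show "(\<lambda>i. stretched_exp_deriv \<alpha> t i x / fact i * y ^ i) sums exp (- t * (x + y) powr \<alpha>)"
    using * unfolding f_eq suminf_mult[OF sm'] by (simp add: stretched_exp_deriv_def mult.commute)
qed

text \<open>Termwise differentiation inside the disc of convergence. The series agrees with g only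
  for displacements below r, so the derivative is transferred by local equality and a shift of the
  origin.\<close>

lemma has_real_derivative_of_power_series:
  fixes g :: "real \<Rightarrow> real"
  assumes sums: "\<And>y. \<bar>y\<bar> < r \<Longrightarrow> (\<lambda>i. c i * y ^ i) sums g (x + y)" and y: "\<bar>y\<bar> < r"
  shows "(g has_real_derivative (\<Sum>i. diffs c i * y ^ i)) (at (x + y))"
    and "summable (\<lambda>i. diffs c i * y ^ i)"
proof -
  \<comment> \<open>Termwise differentiation at y asks for convergence at a point strictly farther
    out.\<close>
  obtain z where z: "\<bar>y\<bar> < z" "z < r" using y dense by blast
  have "((\<lambda>y. \<Sum>i. c i * y ^ i) has_real_derivative (\<Sum>i. diffs c i * y ^ i)) (at y)"
    by (rule termdiffs_strong[OF sums_summable[OF sums], of z]) (use z in auto)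
  moreover have "\<forall>\<^sub>F u in nhds y. u \<in> ball 0 r"
    using y by (intro eventually_nhds_in_open) auto
  then have "\<forall>\<^sub>F u in nhds y. (\<Sum>i. c i * u ^ i) = g (x + u)"
    by eventually_elim (use sums in \<open>auto simp: sums_iff\<close>)
  ultimately have "((\<lambda>u. g (x + u)) has_real_derivative (\<Sum>i. diffs c i * y ^ i)) (at y)"
    by (subst (asm) DERIV_cong_ev) auto
  then show "(g has_real_derivative (\<Sum>i. diffs c i * y ^ i)) (at (x + y))"
    unfolding add.commute[of x] DERIV_shift .
  show "summable (\<lambda>i. diffs c i * y ^ i)"
    by (rule termdiff_converges[of _ r]) (use y sums in \<open>auto simp: sums_iff\<close>)
qed

text \<open>Induction on k. Differentiating the expansion of the k-th derivative about x shifts its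
  coefficients to those for k + 1, so only the value of the new series has to be identified.\<close>

lemma stretched_exp_taylor:
  assumes \<alpha>: "0 < \<alpha>" and y: "\<bar>y\<bar> < x"
  shows "(\<lambda>i. stretched_exp_deriv \<alpha> t (k + i) x / fact i * y ^ i) sums stretched_exp_deriv \<alpha> t k (x + y)"
  using y
proof (induction k arbitrary: x y)
  case 0
  show ?case
  proof (cases "y = 0")
    case True
    then show ?thesis
      using powser_sums_zero[of "\<lambda>i. stretched_exp_deriv \<alpha> t i x / fact i"] by simp
  next
    case False
    then show ?thesis
      using stretched_exp_taylor_0(2)[OF \<alpha> 0] 0 by (simp add: stretched_exp_deriv_0)
  qed
next
  case (Suc k)
  define c where "c x i = stretched_exp_deriv \<alpha> t (k + i) x / fact i" for x i
  have dc: "diffs (c x) = (\<lambda>i. stretched_exp_deriv \<alpha> t (Suc k + i) x / fact i)" for x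
    by (auto simp: fun_eq_iff diffs_def c_def simp del: of_nat_Suc)
  have deriv: "(stretched_exp_deriv \<alpha> t k has_real_derivative (\<Sum>i. diffs (c x) i * y ^ i)) (at (x + y))"
    if "\<bar>y\<bar> < x" for x y
    using that Suc.IH by (intro has_real_derivative_of_power_series(1)[of x]) (simp_all add: c_def)
  have "0 < x + y" "\<bar>y\<bar> < x" using Suc.prems by linarith+
  \<comment> \<open>Both sides are the derivative of \<open>stretched_exp_deriv \<alpha> t k\<close>
    at x + y, once from the expansion about x and once from the expansion about x + y at
    displacement 0. Of the latter only the constant coefficient survives.\<close>
  have "(\<Sum>i. diffs (c x) i * y ^ i) = (\<Sum>i. diffs (c (x + y)) i * 0 ^ i)"
    using deriv[of y x] deriv[of 0 "x + y"] \<open>0 < x + y\<close> \<open>\<bar>y\<bar> < x\<close> by (auto intro: DERIV_unique)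
  also have "\<dots> = stretched_exp_deriv \<alpha> t (Suc k) (x + y)"
    unfolding powser_zero by (simp add: dc)
  finally have "(\<Sum>i. diffs (c x) i * y ^ i) = stretched_exp_deriv \<alpha> t (Suc k) (x + y)" .
  moreover have "summable (\<lambda>i. diffs (c x) i * y ^ i)"
    using \<open>\<bar>y\<bar> < x\<close> Suc.IH by (intro has_real_derivative_of_power_series(2)[of x]) (simp_all add: c_def)
  ultimately show ?case
    by (simp add: dc sums_iff)
qed

lemma has_real_derivative_stretched_exp_deriv:
  assumes "0 < \<alpha>" and "0 < x"
  shows "(stretched_exp_deriv \<alpha> t k has_real_derivative stretched_exp_deriv \<alpha> t (Suc k) x) (at x)"
  using has_real_derivative_of_power_series(1)[of x "\<lambda>i. stretched_exp_deriv \<alpha> t (k + i) x / fact i"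
      "stretched_exp_deriv \<alpha> t k" x 0] stretched_exp_taylor[OF assms(1)] assms(2)
  unfolding powser_zero by (simp add: diffs_def)

section \<open>The Wright function as a derivative of the stretched exponential function\<close>

lemma wright_psi11_eq_stretched_exp_deriv:
  assumes "0 < \<alpha>" and x: "0 < x"
  shows "wright_psi11 1 \<alpha> (1 - real k - real i) \<alpha> (- (x powr \<alpha>) * t)
       = x ^ (k + i) * stretched_exp_deriv \<alpha> t (k + i) x"
proof -
  define n where "n = k + i"
  have "(- (x powr \<alpha>) * t) ^ m / fact m * (Gamma (1 + \<alpha> * real m) * rGamma (1 - real k - real i + \<alpha> * real m))
      = x ^ n * fact n * ((- t) ^ m / fact m * (\<alpha> * real m gchoose n) * x powr (\<alpha> * real m - real n))" for m
  proof -
    have 1: "(x powr \<alpha>) ^ m = x ^ n * x powr (\<alpha> * real m - real n)"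
      using x by (simp add: powr_realpow[symmetric] powr_add[symmetric] powr_powr)
    have "\<alpha> * real m + 1 > 0"
      using assms by (simp add: add_nonneg_pos)
    then have "\<alpha> * real m + 1 \<notin> \<int>\<^sub>\<le>\<^sub>0"
      by (auto elim!: nonpos_Ints_cases)
    \<comment> \<open>If \<alpha> m is an integer below n, both sides vanish: \<open>rGamma\<close>
      is evaluated at a pole of Gamma, and the binomial coefficient has a zero factor.\<close>
    then have 2: "Gamma (1 + \<alpha> * real m) * rGamma (1 - real k - real i + \<alpha> * real m)
        = fact n * (\<alpha> * real m gchoose n)"
      by (subst gbinomial_Gamma) (simp_all add: Gamma_def n_def divide_inverse algebra_simps)
    have "(- (x powr \<alpha>) * t) ^ m = (x powr \<alpha>) ^ m * (- t) ^ m"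
      by (simp flip: power_mult_distrib)
    then show ?thesis
      unfolding 1 2 by simp
  qed
  \<comment> \<open>The displacement does not occur in this series, so any nonzero one smaller than
    x serves; x / 2 is a choice.\<close>
  moreover have "summable (\<lambda>m. (- t) ^ m / fact m * (\<alpha> * real m gchoose n) * x powr (\<alpha> * real m - real n))"
    by (rule stretched_exp_taylor_0(1)[of _ "x / 2"]) (use assms in auto)
  ultimately show ?thesis
    unfolding wright_psi11_def n_def[symmetric]
    by (simp only: suminf_mult stretched_exp_deriv_def n_def[symmetric])
qed

section \<open>Abel's limit theorem and the boundary of the disc of convergence\<close>

lemma Abel_limit_at_left_1:
  fixes a :: "nat \<Rightarrow> real"
  assumes "summable a"
  shows "((\<lambda>x. \<Sum>n. a n * x ^ n) \<longlongrightarrow> suminf a) (at_left 1)"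
proof -
  \<comment> \<open>The tails satisfy r 0 = suminf a and a n = r n - r (Suc n). Hence the power
    series of a differs from suminf a only by the factor 1 / x and the error (1 - x) * R x, and it
    remains to show that this error vanishes as x tends to 1.\<close>
  define r where "r n = suminf a - (\<Sum>i<n. a i)" for n
  have r: "r \<longlonglongrightarrow> 0"
    unfolding r_def using tendsto_diff[OF tendsto_const[of "suminf a"] summable_LIMSEQ[OF assms]] by simp
  then obtain C where C: "0 < C" "\<And>n. \<bar>r n\<bar> \<le> C"
    using convergent_imp_Bseq[of r] by (force simp: Bseq_def convergent_def)
  have sm: "summable (\<lambda>n. \<bar>r n * x ^ n\<bar>)" if "0 < x" "x < 1" for x
  proof (rule summable_comparison_test')
    show "summable (\<lambda>n. C * x ^ n)"
      using that by (intro summable_mult summable_geometric) simp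
    show "norm \<bar>r n * x ^ n\<bar> \<le> C * x ^ n" for n
      using that C(2)[of n] by (simp add: abs_mult power_abs mult_right_mono)
  qed
  define R where "R x = (\<Sum>n. r n * x ^ n)" for x
  \<comment> \<open>Summation by parts.\<close>
  have eq: "(\<Sum>n. a n * x ^ n) = (suminf a - (1 - x) * R x) / x" if "0 < x" "x < 1" for x
  proof -
    have "(\<lambda>n. r n * x ^ n) sums R x"
      unfolding R_def using summable_rabs_cancel[OF sm[OF that]] by (rule summable_sums)
    moreover from this have "(\<lambda>n. r (Suc n) * x ^ Suc n) sums (R x - suminf a)"
      by (subst sums_Suc_iff) (simp add: r_def)
    ultimately have "(\<lambda>n. x * (r n * x ^ n) - r (Suc n) * x ^ Suc n) sums (x * R x - (R x - suminf a))"
      by (intro sums_diff sums_mult)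
    also have "(\<lambda>n. x * (r n * x ^ n) - r (Suc n) * x ^ Suc n) = (\<lambda>n. x * (a n * x ^ n))"
      by (simp add: r_def fun_eq_iff algebra_simps)
    finally have "(\<lambda>n. a n * x ^ n) sums ((x * R x - (R x - suminf a)) / x)"
      using sums_mult[of _ _ "1 / x"] that by fastforce
    then show ?thesis
      by (simp add: sums_iff algebra_simps)
  qed
  have "((\<lambda>x. (1 - x) * R x) \<longlongrightarrow> 0) (at_left 1)"
  proof (rule tendstoI)
    fix e :: real assume e: "0 < e"
    \<comment> \<open>Tails of index at least N contribute at most e / 2 after multiplication by 1 -
      x, since the geometric series sums to 1 / (1 - x). The finitely many others are bounded by
      \<open>K\<close>, which the factor 1 - x makes negligible.\<close>
    obtain N where N: "\<And>n. n \<ge> N \<Longrightarrow> \<bar>r n\<bar> < e / 2"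
      using r e unfolding LIMSEQ_def by (metis dist_0_norm dist_commute half_gt_zero real_norm_def)
    define K where "K = (\<Sum>n<N. \<bar>r n\<bar>)"
    have "((\<lambda>x. (1 - x) * K) \<longlongrightarrow> (1 - 1) * K) (at_left 1)"
      by (intro tendsto_intros)
    then have "\<forall>\<^sub>F x in at_left 1. (1 - x) * K < e / 2"
      using e by (intro order_tendstoD(2)[of _ 0]) auto
    moreover have "\<forall>\<^sub>F x in at_left (1::real). x \<in> {0<..<1}"
      by (rule eventually_at_leftI[of 0]) auto
    ultimately show "\<forall>\<^sub>F x in at_left 1. dist ((1 - x) * R x) 0 < e"
    proof eventually_elim
      case (elim x)
      then have x: "0 < x" "x < 1" by auto
      have "\<bar>R x\<bar> \<le> (\<Sum>n. \<bar>r n * x ^ n\<bar>)"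
        unfolding R_def by (rule summable_rabs[OF sm[OF x]])
      also have "\<dots> = (\<Sum>n. \<bar>r (n + N) * x ^ (n + N)\<bar>) + (\<Sum>n<N. \<bar>r n * x ^ n\<bar>)"
        by (rule suminf_split_initial_segment[OF sm[OF x]])
      also have "(\<Sum>n<N. \<bar>r n * x ^ n\<bar>) \<le> K"
        unfolding K_def using x by (intro sum_mono) (auto simp: abs_mult power_abs intro!: mult_left_le power_le_one)
      also have "(\<Sum>n. \<bar>r (n + N) * x ^ (n + N)\<bar>) \<le> (\<Sum>n. e / 2 * x ^ n)"
      proof (rule suminf_le)
        show "\<bar>r (n + N) * x ^ (n + N)\<bar> \<le> e / 2 * x ^ n" for n
          unfolding abs_mult using x N[of "n + N"] power_decreasing[of n "n + N" x]
          by (intro mult_mono) auto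
        show "summable (\<lambda>n. \<bar>r (n + N) * x ^ (n + N)\<bar>)"
          using summable_ignore_initial_segment[OF sm[OF x]] by blast
        show "summable (\<lambda>n. e / 2 * x ^ n)"
          using x by (intro summable_mult summable_geometric) simp
      qed
      also have "(\<Sum>n. e / 2 * x ^ n) = e / 2 / (1 - x)"
        using x by (subst suminf_mult) (auto simp: summable_geometric suminf_geometric)
      finally have "\<bar>R x\<bar> \<le> e / 2 / (1 - x) + K" by simp
      then have "(1 - x) * \<bar>R x\<bar> \<le> (1 - x) * (e / 2 / (1 - x) + K)"
        using x by (intro mult_left_mono) auto
      also have "\<dots> = e / 2 + (1 - x) * K"
        using x by (simp add: field_simps)
      also have "\<dots> < e" using elim by simp
      finally show ?case using x by (simp add: abs_mult)
    qed
  qed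
  then have "((\<lambda>x. (suminf a - (1 - x) * R x) / x) \<longlongrightarrow> (suminf a - 0) / 1) (at_left 1)"
    by (intro tendsto_intros) auto
  moreover have "\<forall>\<^sub>F x in at_left 1. (suminf a - (1 - x) * R x) / x = (\<Sum>n. a n * x ^ n)"
    using eq by (intro eventually_at_leftI[of 0]) auto
  ultimately show ?thesis
    by (simp add: tendsto_cong)
qed

lemma stretched_exp_deriv_t_0: "stretched_exp_deriv \<alpha> 0 n x = (if n = 0 then x powr 0 else 0)"
  unfolding stretched_exp_deriv_def by (subst suminf_finite[of "{0}"]) (cases n; auto)+

text \<open>Convergence at y > x would make the differentiated series continuous at displacement -x,
  which corresponds to the argument 0. For arguments h > 0 below x its sum is the derivative of
  \<open>exp (- t * h powr \<alpha>)\<close>, which tends to minus infinity as h decreases to 0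
  because \<alpha> < 1.\<close>

lemma not_summable_stretched_exp_taylor:
  assumes \<alpha>: "0 < \<alpha>" "\<alpha> < 1" and t: "0 < t" and x: "0 < x" "x < y"
  shows "\<not> summable (\<lambda>i. stretched_exp_deriv \<alpha> t i x / fact i * y ^ i)"
proof
  define c where "c i = stretched_exp_deriv \<alpha> t i x / fact i" for i
  assume "summable (\<lambda>i. stretched_exp_deriv \<alpha> t i x / fact i * y ^ i)"
  then have "summable (\<lambda>i. c i * z ^ i)" if "\<bar>z\<bar> < y" for z
    using that x powser_inside[of c y z] by (simp add: c_def)
  then have sd: "summable (\<lambda>i. diffs c i * z ^ i)" if "\<bar>z\<bar> < y" for z
    using that by (intro termdiff_converges[of _ y]) auto
  \<comment> \<open>Convergence at \<open>K\<close> makes -x an interior point of the disc, where a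
    power series is continuous.\<close>
  obtain K where K: "x < K" "K < y" using x dense by blast
  have "isCont (\<lambda>z. \<Sum>i. diffs c i * z ^ i) (- x)"
    by (rule isCont_powser[OF sd[of K]]) (use K x in auto)
  then have "((\<lambda>z. \<Sum>i. diffs c i * z ^ i) \<longlongrightarrow> (\<Sum>i. diffs c i * (- x) ^ i)) (at (- x))"
    by (simp add: isCont_def)
  moreover have "filterlim (\<lambda>h. h - x) (at (- x)) (at_right 0)"
    by (rule filterlim_atI) (auto intro!: tendsto_eq_intros simp: eventually_at_filter)
  ultimately have "((\<lambda>h. \<Sum>i. diffs c i * (h - x) ^ i) \<longlongrightarrow> (\<Sum>i. diffs c i * (- x) ^ i)) (at_right 0)"
    by (rule filterlim_compose)
  moreover have "\<forall>\<^sub>F h in at_right 0. (\<Sum>i. diffs c i * (h - x) ^ i) = - (t * \<alpha> * h powr (\<alpha> - 1)) * exp (- t * h powr \<alpha>)"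
  proof (rule eventually_at_rightI)
    fix h assume h: "h \<in> {0<..<x}"
    have "diffs c = (\<lambda>i. stretched_exp_deriv \<alpha> t (Suc 0 + i) x / fact i)"
      by (auto simp: fun_eq_iff diffs_def c_def simp del: of_nat_Suc)
    then have "(\<Sum>i. diffs c i * (h - x) ^ i) = stretched_exp_deriv \<alpha> t (Suc 0) h"
      using stretched_exp_taylor[OF \<alpha>(1), of "h - x" x t "Suc 0"] h by (simp add: sums_iff)
    \<comment> \<open>The same derivative is computed by the chain rule and as
      \<open>stretched_exp_deriv\<close> of order 1; uniqueness puts the sum of the series in closed
      form.\<close>
    moreover have "((\<lambda>h. exp (- t * h powr \<alpha>)) has_real_derivative - (t * \<alpha> * h powr (\<alpha> - 1)) * exp (- t * h powr \<alpha>)) (at h)"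
      using h by (auto intro!: derivative_eq_intros)
    moreover have "((\<lambda>h. exp (- t * h powr \<alpha>)) has_real_derivative stretched_exp_deriv \<alpha> t (Suc 0) h) (at h)"
    proof (subst DERIV_cong_ev[OF refl _ refl])
      show "(stretched_exp_deriv \<alpha> t 0 has_real_derivative stretched_exp_deriv \<alpha> t (Suc 0) h) (at h)"
        using h by (intro has_real_derivative_stretched_exp_deriv \<alpha>) auto
      have "\<forall>\<^sub>F h in nhds h. h \<in> {0<..}"
        using h by (intro eventually_nhds_in_open) auto
      then show "\<forall>\<^sub>F h in nhds h. exp (- t * h powr \<alpha>) = stretched_exp_deriv \<alpha> t 0 h"
        by eventually_elim (simp add: stretched_exp_deriv_0)
    qed
    ultimately show "(\<Sum>i. diffs c i * (h - x) ^ i) = - (t * \<alpha> * h powr (\<alpha> - 1)) * exp (- t * h powr \<alpha>)"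
      by (metis DERIV_unique)
  qed (use x in simp)
  ultimately have "((\<lambda>h. - (t * \<alpha> * h powr (\<alpha> - 1)) * exp (- t * h powr \<alpha>)) \<longlongrightarrow> (\<Sum>i. diffs c i * (- x) ^ i)) (at_right 0)"
    by (simp cong: tendsto_cong)
  moreover have "filterlim (\<lambda>h. - (t * \<alpha> * h powr (\<alpha> - 1)) * exp (- t * h powr \<alpha>)) at_bot (at_right 0)"
    using \<alpha> t by real_asymp
  ultimately show False
    using not_tendsto_and_filterlim_at_infinity[OF trivial_limit_at_right_real]
      filterlim_at_bot_imp_at_infinity by blast
qed

text \<open>For t = 0 the function is constant; for y < x this is the Taylor expansion; y = x is
  reached by Abel's theorem; and y > x with t > 0 contradicts summability for k = 0.\<close>

lemma stretched_exp_taylor_summable: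
  assumes \<alpha>: "0 < \<alpha>" "\<alpha> < 1" and t: "0 \<le> t" and x: "0 < x" "0 < y"
    and sm: "\<And>k. summable (\<lambda>i. stretched_exp_deriv \<alpha> t (k + i) x / fact i * y ^ i)"
  shows "(\<lambda>i. stretched_exp_deriv \<alpha> t (k + i) x / fact i * y ^ i) sums stretched_exp_deriv \<alpha> t k (x + y)"
proof -
  consider "t = 0" | "y < x" | "y = x" | "t \<noteq> 0" "x < y" by linarith
  then show ?thesis
  proof cases
    case 1
    then have "(\<lambda>i. stretched_exp_deriv \<alpha> t (k + i) x / fact i * y ^ i)
        = (\<lambda>i. if i = 0 then stretched_exp_deriv \<alpha> t k (x + y) else 0)"
      using x by (auto simp: fun_eq_iff stretched_exp_deriv_t_0)
    then show ?thesis
      using sums_single[of 0 "\<lambda>_. stretched_exp_deriv \<alpha> t k (x + y)"] by simp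
  next
    case 2
    then show ?thesis using x by (intro stretched_exp_taylor[OF \<alpha>(1)]) auto
  next
    case 3
    define a where "a i = stretched_exp_deriv \<alpha> t (k + i) x / fact i * x ^ i" for i
    have a: "summable a" unfolding a_def using sm[of k] 3 by simp
    \<comment> \<open>For s < 1 the displacement x * s is strictly inside the radius x, so the
      Taylor expansion applies. Continuity of the derivative at x + x then allows s to tend to
      1.\<close>
    have "\<forall>\<^sub>F s in at_left 1. (\<Sum>i. a i * s ^ i) = stretched_exp_deriv \<alpha> t k (x + x * s)"
    proof (rule eventually_at_leftI)
      fix s :: real assume "s \<in> {0<..<1}"
      then show "(\<Sum>i. a i * s ^ i) = stretched_exp_deriv \<alpha> t k (x + x * s)"
        using stretched_exp_taylor[OF \<alpha>(1), of "x * s" x t k] x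
        by (simp add: a_def sums_iff power_mult_distrib mult_ac abs_mult)
    qed simp
    with Abel_limit_at_left_1[OF a]
    have "((\<lambda>s. stretched_exp_deriv \<alpha> t k (x + x * s)) \<longlongrightarrow> suminf a) (at_left 1)"
      by (simp cong: tendsto_cong)
    moreover have "((\<lambda>s. stretched_exp_deriv \<alpha> t k (x + x * s)) \<longlongrightarrow> stretched_exp_deriv \<alpha> t k (x + x * 1)) (at_left 1)"
    proof (rule isCont_tendsto_compose[where g = "stretched_exp_deriv \<alpha> t k"])
      show "isCont (stretched_exp_deriv \<alpha> t k) (x + x * 1)"
        by (rule DERIV_isCont[OF has_real_derivative_stretched_exp_deriv[OF \<alpha>(1)]]) (use x in simp)
    qed (intro tendsto_intros)
    ultimately have "suminf a = stretched_exp_deriv \<alpha> t k (x + x)"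
      using tendsto_unique[OF trivial_limit_at_left_real] by fastforce
    then show ?thesis using a 3 by (simp add: a_def[abs_def] sums_iff)
  next
    case 4
    then show ?thesis
      using not_summable_stretched_exp_taylor[OF \<alpha> _ x(1), of t y] sm[of 0] t by auto
  qed
qed

section \<open>Subordinated counting processes\<close>

text \<open>Right-continuity forces |N u - N s| < 1 just after s, and distinct natural numbers are
  at distance at least 1.\<close>

lemma cadlag_nat_eventually_const:
  assumes "cadlag (\<lambda>t. real (N t))" and "0 \<le> s"
  shows "\<forall>\<^sub>F u in at_right s. N u = N s"
proof -
  have "((\<lambda>t. real (N t)) \<longlongrightarrow> real (N s)) (at_right s)"
    using assms by (auto simp: cadlag_def continuous_within)
  then have "\<forall>\<^sub>F u in at_right s. dist (real (N u)) (real (N s)) < 1"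
    by (rule tendstoD) simp
  then show ?thesis
    by eventually_elim (simp add: dist_real_def)
qed

text \<open>Monotonicity makes S u approach S t from the right, the side on which N is locally
  constant. The case S u = S t is separate because a right neighbourhood omits its end
  point.\<close>

lemma cadlag_nat_comp_eventually_const:
  assumes N: "cadlag (\<lambda>t. real (N t))" and S: "cadlag S" "mono_on {0..} S" and t: "0 \<le> t" and S0: "0 \<le> S t"
  shows "\<forall>\<^sub>F u in at_right t. N (S u) = N (S t)"
proof -
  obtain b where b: "S t < b" "\<And>v. S t < v \<Longrightarrow> v < b \<Longrightarrow> N v = N (S t)"
    using cadlag_nat_eventually_const[OF N S0] unfolding eventually_at_right_field by blast
  have "(S \<longlongrightarrow> S t) (at_right t)"
    using S(1) t by (auto simp: cadlag_def continuous_within)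
  then have "\<forall>\<^sub>F u in at_right t. S u < b"
    using b(1) by (rule order_tendstoD)
  moreover have "\<forall>\<^sub>F u in at_right t. t < u"
    by (simp add: eventually_at_filter)
  ultimately show ?thesis
  proof eventually_elim
    case (elim u)
    then have "S t \<le> S u" using mono_onD[OF S(2), of t u] t by simp
    then show ?case using b(2)[of "S u"] elim by (cases "S u = S t") auto
  qed
qed

text \<open>If Z t < l, local constancy gives some b > t before which Z stays below l, so the
  infimum is at least b. Without this gap the level could be reached at times decreasing to t, and
  the strict inequality would fail.\<close>

lemma Inf_reaching_times_gt_iff:
  fixes Z :: "real \<Rightarrow> nat"
  assumes mono: "mono_on {0..} Z" and const: "\<forall>\<^sub>F u in at_right t. Z u = Z t" and t: "0 \<le> t"
  shows "ereal t < Inf (ereal ` {s. 0 \<le> s \<and> l \<le> Z s}) \<longleftrightarrow> Z t < l"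
proof
  assume less: "ereal t < Inf (ereal ` {s. 0 \<le> s \<and> l \<le> Z s})"
  have "t \<notin> {s. 0 \<le> s \<and> l \<le> Z s}"
  proof
    assume "t \<in> {s. 0 \<le> s \<and> l \<le> Z s}"
    from Inf_lower[OF imageI[OF this, of ereal]] less show False
      by (simp add: not_less[symmetric])
  qed
  then show "Z t < l" using t by simp
next
  assume l: "Z t < l"
  obtain b where b: "t < b" "\<And>u. t < u \<Longrightarrow> u < b \<Longrightarrow> Z u = Z t"
    using const unfolding eventually_at_right_field by blast
  have "ereal b \<le> Inf (ereal ` {s. 0 \<le> s \<and> l \<le> Z s})"
  proof (rule Inf_greatest, clarsimp)
    fix s assume s: "0 \<le> s" "l \<le> Z s"
    show "b \<le> s"
    proof (rule ccontr)
      assume "\<not> b \<le> s"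
      then have "Z s \<le> Z t"
        using b(2)[of s] mono_onD[OF mono, of s t] s t by (cases "t < s") auto
      with s l show False by simp
    qed
  qed
  then show "ereal t < Inf (ereal ` {s. 0 \<le> s \<and> l \<le> Z s})"
    by (rule less_le_trans[rotated]) (use b(1) in simp)
qed

section \<open>Counting at an independent random time\<close>

lemma vimage_in_path_events:
  assumes "0 \<le> t" and A: "A \<in> sets E"
    and sp: "\<And>s \<omega>. 0 \<le> s \<Longrightarrow> \<omega> \<in> space M \<Longrightarrow> X s \<omega> \<in> space E"
  shows "X t -` A \<inter> space M \<in> path_events M E X"
proof -
  have "(\<lambda>f. f t) -` A \<inter> space (Pi\<^sub>M {0..} (\<lambda>_. E)) \<in> sets (Pi\<^sub>M {0..} (\<lambda>_. E))"
    using assms by (intro measurable_sets[OF measurable_component_singleton]) auto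
  from in_vimage_algebra[OF this, of "\<lambda>\<omega>. \<lambda>t\<in>{0..}. X t \<omega>" "space M"]
  have "(\<lambda>\<omega>. \<lambda>t\<in>{0..}. X t \<omega>) -` ((\<lambda>f. f t) -` A \<inter> space (Pi\<^sub>M {0..} (\<lambda>_. E))) \<inter> space M \<in> path_events M E X"
    unfolding path_events_def .
  also have "(\<lambda>\<omega>. \<lambda>t\<in>{0..}. X t \<omega>) -` ((\<lambda>f. f t) -` A \<inter> space (Pi\<^sub>M {0..} (\<lambda>_. E))) \<inter> space M = X t -` A \<inter> space M"
    using assms by (auto simp: space_PiM)
  finally show ?thesis .
qed

context prob_space begin

lemma expectation_nat_function_sums:
  fixes J :: "'a \<Rightarrow> nat" and \<phi> :: "nat \<Rightarrow> real"
  assumes J: "J \<in> measurable M (count_space UNIV)" and \<phi>: "\<And>j. \<bar>\<phi> j\<bar> \<le> C"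
  shows "(\<lambda>j. \<phi> j * prob (J -` {j} \<inter> space M)) sums expectation (\<lambda>\<omega>. \<phi> (J \<omega>))"
proof -
  \<comment> \<open>These finite sums are \<phi>(J) truncated to J < n; the constant C dominates
    them all.\<close>
  let ?f = "\<lambda>n \<omega>. \<Sum>j<n. \<phi> j * indicator (J -` {j} \<inter> space M) \<omega>"
  have mJ[measurable]: "J -` {j} \<inter> space M \<in> events" for j
    using J by (rule measurable_sets) simp
  have eq: "?f n \<omega> = (if J \<omega> < n then \<phi> (J \<omega>) else 0)" if "\<omega> \<in> space M" for n \<omega>
  proof -
    have "?f n \<omega> = (\<Sum>j<n. if j = J \<omega> then \<phi> j else 0)"
      using that by (intro sum.cong) (auto simp: indicator_def)
    then show ?thesis by simp
  qed
  have [measurable]: "(\<lambda>\<omega>. \<phi> (J \<omega>)) \<in> borel_measurable M"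
    using measurable_compose[OF J, of \<phi> borel] by simp
  have C0: "0 \<le> C" using \<phi>[of 0] by linarith
  have "(\<lambda>n. expectation (?f n)) \<longlonglongrightarrow> expectation (\<lambda>\<omega>. \<phi> (J \<omega>))"
  proof (rule integral_dominated_convergence[where w = "\<lambda>_. C"])
    show "AE \<omega> in M. (\<lambda>n. ?f n \<omega>) \<longlonglongrightarrow> \<phi> (J \<omega>)"
    proof (rule AE_I2)
      fix \<omega> assume \<omega>: "\<omega> \<in> space M"
      have "\<forall>\<^sub>F n in sequentially. ?f n \<omega> = \<phi> (J \<omega>)"
        using eventually_gt_at_top[of "J \<omega>"] by eventually_elim (simp add: eq[OF \<omega>])
      then show "(\<lambda>n. ?f n \<omega>) \<longlonglongrightarrow> \<phi> (J \<omega>)" by (rule tendsto_eventually)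
    qed
    show "AE \<omega> in M. norm (?f n \<omega>) \<le> C" for n
      by (intro AE_I2, subst eq) (use \<phi> C0 in auto)
    show "?f n \<in> borel_measurable M" for n
      by measurable
  qed auto
  moreover have "expectation (?f n) = (\<Sum>j<n. \<phi> j * prob (J -` {j} \<inter> space M))" for n
    by (subst Bochner_Integration.integral_sum) (auto simp: Int_absorb1 emeasure_eq_measure)
  ultimately show ?thesis by (simp add: sums_def)
qed

text \<open>
  Approximating \<open>S\<close> from above by the random times \<open>\<tau>\<close>, which take countably many values, reduces the
  claim to deterministic times; right-continuity of \<open>Z\<close> makes the approximation exact eventually.
\<close>

lemma prob_subordinated_count:
  fixes S :: "'a \<Rightarrow> real" and Z :: "real \<Rightarrow> 'a \<Rightarrow> nat"
  assumes S: "S \<in> borel_measurable M" "\<And>\<omega>. \<omega> \<in> space M \<Longrightarrow> 0 \<le> S \<omega>"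
    and Z: "\<And>s. 0 < s \<Longrightarrow> Z s -` {k} \<inter> space M \<in> events"
    and const: "\<And>\<omega>. \<omega> \<in> space M \<Longrightarrow> \<forall>\<^sub>F u in at_right (S \<omega>). Z u \<omega> = Z (S \<omega>) \<omega>"
    and p: "\<And>s A. 0 < s \<Longrightarrow> A \<in> sets borel \<Longrightarrow>
              prob (S -` A \<inter> (Z s -` {k}) \<inter> space M) = prob (S -` A \<inter> space M) * p s"
    and p_bound: "\<And>s. 0 \<le> s \<Longrightarrow> \<bar>p s\<bar> \<le> 1" and p_cont: "continuous_on {0..} p"
  shows "{\<omega> \<in> space M. Z (S \<omega>) \<omega> = k} \<in> events \<and>
         prob {\<omega> \<in> space M. Z (S \<omega>) \<omega> = k} = expectation (\<lambda>\<omega>. p (S \<omega>))"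
proof -
  \<comment> \<open>With mesh 1 / Suc n, \<open>\<tau> n (J n \<omega>)\<close> is the first grid
    point strictly above S. Strictness makes it approach S from the right and keeps it positive even
    where S is 0.\<close>
  define J where "J n \<omega> = nat \<lfloor>real (Suc n) * S \<omega>\<rfloor>" for n \<omega>
  define \<tau> where "\<tau> n j = real (Suc j) / real (Suc n)" for n j
  define A where "A n = {\<omega> \<in> space M. Z (\<tau> n (J n \<omega>)) \<omega> = k}" for n
  define A' where "A' = {\<omega> \<in> space M. Z (S \<omega>) \<omega> = k}"
  note [measurable] = S(1)
  have \<tau>_pos: "0 < \<tau> n j" for n j by (simp add: \<tau>_def)
  have JM[measurable]: "J n \<in> measurable M (count_space UNIV)" for n
    unfolding J_def by measurable
  have \<tau>_gt: "S \<omega> < \<tau> n (J n \<omega>)" and \<tau>_le: "\<tau> n (J n \<omega>) \<le> S \<omega> + inverse (real (Suc n))"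
    if "\<omega> \<in> space M" for n \<omega>
  proof -
    have "0 \<le> real (Suc n) * S \<omega>" using S(2)[OF that] by simp
    then have "real (J n \<omega>) = real_of_int \<lfloor>real (Suc n) * S \<omega>\<rfloor>" by (simp add: J_def)
    then have "real (Suc n) * S \<omega> < real (Suc (J n \<omega>))" "real (Suc (J n \<omega>)) \<le> real (Suc n) * S \<omega> + 1"
      by linarith+
    then show "S \<omega> < \<tau> n (J n \<omega>)" "\<tau> n (J n \<omega>) \<le> S \<omega> + inverse (real (Suc n))"
      by (simp_all add: \<tau>_def field_simps del: of_nat_Suc)
  qed
  have \<tau>_lim: "(\<lambda>n. \<tau> n (J n \<omega>)) \<longlonglongrightarrow> S \<omega>" if "\<omega> \<in> space M" for \<omega>
  proof (rule tendsto_sandwich[where f = "\<lambda>_. S \<omega>"])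
    show "(\<lambda>n. S \<omega> + inverse (real (Suc n))) \<longlonglongrightarrow> S \<omega>"
      using tendsto_add[OF tendsto_const LIMSEQ_inverse_real_of_nat, of "S \<omega>"] by simp
  qed (use less_imp_le[OF \<tau>_gt[OF that]] \<tau>_le[OF that] in auto)
  have A_eq: "A n = (\<Union>j. J n -` {j} \<inter> (Z (\<tau> n j) -` {k}) \<inter> space M)" for n
    by (auto simp: A_def)
  have Aj: "J n -` {j} \<inter> (Z (\<tau> n j) -` {k}) \<inter> space M \<in> events" for n j
  proof -
    have "J n -` {j} \<inter> (Z (\<tau> n j) -` {k}) \<inter> space M = (J n -` {j} \<inter> space M) \<inter> (Z (\<tau> n j) -` {k} \<inter> space M)"
      by auto
    then show ?thesis using Z[OF \<tau>_pos] measurable_sets[OF JM, of "{j}"] by auto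
  qed
  have A_events[measurable]: "A n \<in> events" for n
    unfolding A_eq using Aj by (intro sets.countable_UN) auto
  have lim: "(\<lambda>n. indicator (A n) \<omega> :: real) \<longlonglongrightarrow> indicator A' \<omega>" if \<omega>: "\<omega> \<in> space M" for \<omega>
  proof (rule tendsto_eventually)
    have "filterlim (\<lambda>n. \<tau> n (J n \<omega>)) (at_right (S \<omega>)) sequentially"
      using \<tau>_lim[OF \<omega>] \<tau>_gt[OF \<omega>] by (intro tendsto_imp_filterlim_at_right) auto
    from eventually_compose_filterlim[OF const[OF \<omega>] this]
    show "\<forall>\<^sub>F n in sequentially. indicator (A n) \<omega> = (indicator A' \<omega> :: real)"
      by eventually_elim (use \<omega> in \<open>simp add: A_def A'_def indicator_def\<close>)
  qed
  \<comment> \<open>Measurability of \<open>A'\<close> is obtained from the approximation: its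
    indicator is a pointwise limit of indicators of the events \<open>A n\<close>.\<close>
  have ind[measurable]: "(\<lambda>\<omega>. indicator A' \<omega> :: real) \<in> borel_measurable M"
    by (rule borel_measurable_LIMSEQ_real[OF lim]) auto
  have "A' = (\<lambda>\<omega>. indicator A' \<omega> :: real) -` {1} \<inter> space M"
    by (auto simp: A'_def indicator_def split: if_splits)
  then have A'_events[measurable]: "A' \<in> events"
    using measurable_sets[OF ind, of "{1}"] by simp
  have "(\<lambda>n. expectation (indicator (A n))) \<longlonglongrightarrow> expectation (indicator A' :: _ \<Rightarrow> real)"
    by (rule integral_dominated_convergence[where w = "\<lambda>_. 1"]) (use lim in auto)
  then have lim1: "(\<lambda>n. prob (A n)) \<longlonglongrightarrow> prob A'"
    by (simp add: Int_absorb2 A_def A'_def)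
  have pS[measurable]: "(\<lambda>\<omega>. p (S \<omega>)) \<in> borel_measurable M"
  proof -
    have "S \<in> measurable M (restrict_space borel {0..})"
      using S by (intro measurable_restrict_space2) auto
    then show ?thesis
      by (rule measurable_compose[OF _ borel_measurable_continuous_on_restrict[OF p_cont]])
  qed
  have [measurable]: "(\<lambda>\<omega>. p (\<tau> n (J n \<omega>))) \<in> borel_measurable M" for n
    by (rule measurable_compose[OF JM]) simp
  have lim2: "(\<lambda>n. expectation (\<lambda>\<omega>. p (\<tau> n (J n \<omega>)))) \<longlonglongrightarrow> expectation (\<lambda>\<omega>. p (S \<omega>))"
  proof (rule integral_dominated_convergence[where w = "\<lambda>_. 1"])
    show "AE \<omega> in M. (\<lambda>n. p (\<tau> n (J n \<omega>))) \<longlonglongrightarrow> p (S \<omega>)"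
      using S(2) less_imp_le[OF \<tau>_pos]
      by (intro AE_I2 continuous_on_tendsto_compose[OF p_cont \<tau>_lim]) auto
    show "AE \<omega> in M. norm (p (\<tau> n (J n \<omega>))) \<le> 1" for n
      using p_bound[OF less_imp_le[OF \<tau>_pos]] by auto
  qed auto
  have "prob (A n) = expectation (\<lambda>\<omega>. p (\<tau> n (J n \<omega>)))" for n
  proof -
    \<comment> \<open>Splitting by the value of \<open>J n\<close> leaves a grid cell for S
      intersected with a count at a fixed time, to which the assumed product rule applies.\<close>
    have "(\<lambda>j. prob (J n -` {j} \<inter> (Z (\<tau> n j) -` {k}) \<inter> space M)) sums prob (A n)"
      unfolding A_eq using Aj by (intro finite_measure_UNION) (auto simp: disjoint_family_on_def)
    moreover have "prob (J n -` {j} \<inter> (Z (\<tau> n j) -` {k}) \<inter> space M) = p (\<tau> n j) * prob (J n -` {j} \<inter> space M)" for j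
    proof -
      have "J n -` {j} = S -` ((\<lambda>x. nat \<lfloor>real (Suc n) * x\<rfloor>) -` {j})"
        by (auto simp: J_def)
      moreover have "(\<lambda>x::real. nat \<lfloor>real (Suc n) * x\<rfloor>) -` {j} \<inter> space borel \<in> sets borel"
        by (rule measurable_sets[of _ _ "count_space UNIV"]) measurable
      ultimately show ?thesis
        using p[OF \<tau>_pos, of _ n j] by (simp add: mult.commute)
    qed
    ultimately have "(\<lambda>j. p (\<tau> n j) * prob (J n -` {j} \<inter> space M)) sums prob (A n)"
      by simp
    moreover have "(\<lambda>j. p (\<tau> n j) * prob (J n -` {j} \<inter> space M)) sums expectation (\<lambda>\<omega>. p (\<tau> n (J n \<omega>)))"
      by (rule expectation_nat_function_sums[OF JM, of _ 1]) (use p_bound[OF less_imp_le[OF \<tau>_pos]] in auto)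
    ultimately show ?thesis by (rule sums_unique2)
  qed
  with lim1 lim2 have "prob A' = expectation (\<lambda>\<omega>. p (S \<omega>))"
    by (auto intro: LIMSEQ_unique)
  with A'_events show ?thesis
    unfolding A'_def by blast
qed

end

text \<open>The value at 0 gives the constant coefficients. For the others both series are
  differentiated; they still share their sum by uniqueness of derivatives, and the induction
  hypothesis applies to the shifted coefficients.\<close>

lemma power_series_coeff_unique:
  fixes a b :: "nat \<Rightarrow> real"
  assumes r: "0 < r" and a: "\<And>y. \<bar>y\<bar> < r \<Longrightarrow> (\<lambda>i. a i * y ^ i) sums g y"
    and b: "\<And>y. \<bar>y\<bar> < r \<Longrightarrow> (\<lambda>i. b i * y ^ i) sums g y"
  shows "a n = b n"
  using a b
proof (induction n arbitrary: a b g)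
  case 0
  then show ?case
    using r sums_unique2[OF 0(1)[of 0] powser_sums_zero] sums_unique2[OF 0(2)[of 0] powser_sums_zero] by simp
next
  case (Suc n)
  have "diffs a n = diffs b n"
  proof (rule Suc.IH)
    fix y :: real assume y: "\<bar>y\<bar> < r"
    have a: "(g has_real_derivative (\<Sum>i. diffs a i * y ^ i)) (at y)" "summable (\<lambda>i. diffs a i * y ^ i)"
      using has_real_derivative_of_power_series[of r a g 0 y] Suc.prems(1) y by simp_all
    have b: "(g has_real_derivative (\<Sum>i. diffs b i * y ^ i)) (at y)" "summable (\<lambda>i. diffs b i * y ^ i)"
      using has_real_derivative_of_power_series[of r b g 0 y] Suc.prems(2) y by simp_all
    show "(\<lambda>i. diffs a i * y ^ i) sums (\<Sum>i. diffs a i * y ^ i)"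
      using a by (simp add: summable_sums)
    show "(\<lambda>i. diffs b i * y ^ i) sums (\<Sum>i. diffs a i * y ^ i)"
      using b DERIV_unique[OF a(1) b(1)] by (simp add: summable_sums)
  qed
  then show ?case by (simp add: diffs_def del: of_nat_Suc)
qed

section \<open>Poisson mixtures and the law of the total number of shocks\<close>

lemma poisson_weight_bounds:
  assumes "0 \<le> (x::real)"
  shows "0 \<le> x ^ k / fact k * exp (- x)" and "x ^ k / fact k * exp (- x) \<le> 1"
proof -
  show "0 \<le> x ^ k / fact k * exp (- x)" using assms by simp
  show "x ^ k / fact k * exp (- x) \<le> 1"
  \<comment> \<open>For x > 0 the weight is a Poisson mass, hence at most 1; the Poisson law is used
    with a positive mean only.\<close>
  proof (cases "x = 0")
    case True
    then show ?thesis by (simp add: power_0_left)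
  next
    case False
    then show ?thesis using assms pmf_le_1[of "poisson_pmf x" k] by simp
  qed
qed

text \<open>The binomial theorem in probabilistic form: independent Poisson variables add their
  means. It merges the two types of shocks.\<close>

lemma poisson_weight_convolution:
  fixes x y :: real
  shows "(\<Sum>a\<le>k. (x ^ a / fact a * exp (- x)) * (y ^ (k - a) / fact (k - a) * exp (- y)))
       = (x + y) ^ k / fact k * exp (- (x + y))"
proof -
  have "(x + y) ^ k / fact k * exp (- (x + y))
      = (\<Sum>a\<le>k. of_nat (k choose a) * x ^ a * y ^ (k - a) / fact k * exp (- (x + y)))"
    unfolding binomial_ring by (simp add: sum_divide_distrib sum_distrib_right)
  also have "\<dots> = (\<Sum>a\<le>k. (x ^ a / fact a * exp (- x)) * (y ^ (k - a) / fact (k - a) * exp (- y)))"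
  proof (intro sum.cong refl)
    fix a assume "a \<in> {..k}"
    then have "of_nat (k choose a) = (fact k / (fact a * fact (k - a)) :: real)"
      by (intro binomial_fact) simp
    then show "of_nat (k choose a) * x ^ a * y ^ (k - a) / fact k * exp (- (x + y))
        = (x ^ a / fact a * exp (- x)) * (y ^ (k - a) / fact (k - a) * exp (- y))"
      by (simp add: exp_add[symmetric])
  qed
  finally show ?thesis ..
qed

lemma subordinator_nonneg:
  assumes "levy_subordinator M S" and "\<omega> \<in> space M" and "0 \<le> t"
  shows "0 \<le> S t \<omega>"
  using assms mono_onD[of "{0..}" "\<lambda>t. S t \<omega>" 0 t] by (auto simp: levy_subordinator_def levy_process_def)

text \<open>Provides the path conditions of \<open>Inf_reaching_times_gt_iff\<close> for the total
  count.\<close>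

lemma bivariate_tsfpp_paths:
  assumes Q: "bivariate_tsfpp M \<alpha> \<theta> r1 r2 S N1 N2 Q" and \<omega>: "\<omega> \<in> space M"
  shows "mono_on {0..} (\<lambda>t. total_shocks Q t \<omega>)"
    and "0 \<le> t \<Longrightarrow> \<forall>\<^sub>F u in at_right t. total_shocks Q u \<omega> = total_shocks Q t \<omega>"
proof -
  have sub: "levy_subordinator M S" and QS: "Q = subordinated_pair N1 N2 S"
    using Q by (auto simp: bivariate_tsfpp_def tempered_stable_subordinator_def)
  have S: "mono_on {0..} (\<lambda>t. S t \<omega>)" "cadlag (\<lambda>t. S t \<omega>)"
    using sub \<omega> by (auto simp: levy_subordinator_def levy_process_def)
  note S0 = subordinator_nonneg[OF sub \<omega>]
  have N1: "mono_on {0..} (\<lambda>t. N1 t \<omega>)" "cadlag (\<lambda>t. real (N1 t \<omega>))"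
    and N2: "mono_on {0..} (\<lambda>t. N2 t \<omega>)" "cadlag (\<lambda>t. real (N2 t \<omega>))"
    using Q \<omega> by (auto simp: bivariate_tsfpp_def poisson_process_def levy_process_def)
  have Z: "total_shocks Q u \<omega> = N1 (S u \<omega>) \<omega> + N2 (S u \<omega>) \<omega>" for u
    by (simp add: QS total_shocks_def subordinated_pair_def)
  show "mono_on {0..} (\<lambda>t. total_shocks Q t \<omega>)"
    unfolding Z
    using S0 by (intro mono_onI add_mono mono_onD[OF N1(1)] mono_onD[OF N2(1)] mono_onD[OF S(1)]) auto
  assume t: "0 \<le> t"
  show "\<forall>\<^sub>F u in at_right t. total_shocks Q u \<omega> = total_shocks Q t \<omega>"
    using cadlag_nat_comp_eventually_const[OF N1(2) S(2,1) t S0[OF t]]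
      cadlag_nat_comp_eventually_const[OF N2(2) S(2,1) t S0[OF t]]
    unfolding Z by eventually_elim simp
qed

context prob_space begin

lemma poisson_process_prob:
  assumes "poisson_process M r N" and "0 < r" "0 < s" and "N s \<in> measurable M (count_space UNIV)"
  shows "prob (N s -` {a} \<inter> space M) = (r * s) ^ a / fact a * exp (- (r * s))"
proof -
  have "prob (N s -` {a} \<inter> space M) = measure (distr M (count_space UNIV) (N s)) {a}"
    using assms by (subst measure_distr) auto
  also have "\<dots> = pmf (poisson_pmf (r * s)) a"
    using assms by (simp add: poisson_process_def pmf.rep_eq)
  finally show ?thesis using assms by simp
qed

text \<open>Given S t = s, the two independent counts add up to a Poisson variable with mean (r1 +
  r2) * s; \<open>prob_subordinated_count\<close> takes the place of the conditioning.\<close>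

lemma bivariate_tsfpp_prob_expectation:
  assumes Q: "bivariate_tsfpp M \<alpha> \<theta> r1 r2 S N1 N2 Q" and r: "0 < r1" "0 < r2" and t: "0 \<le> t"
  shows "{\<omega> \<in> space M. total_shocks Q t \<omega> = k} \<in> events"
    and "prob {\<omega> \<in> space M. total_shocks Q t \<omega> = k}
       = expectation (\<lambda>\<omega>. ((r1 + r2) * S t \<omega>) ^ k / fact k * exp (- ((r1 + r2) * S t \<omega>)))"
proof -
  have sub: "levy_subordinator M S" and QS: "Q = subordinated_pair N1 N2 S"
    and P1: "poisson_process M r1 N1" and P2: "poisson_process M r2 N2"
    and indep: "indep_sets ((!) [path_events M borel S, path_events M (count_space UNIV) N1,
             path_events M (count_space UNIV) N2]) {..<3::nat}"
    using Q by (auto simp: bivariate_tsfpp_def tempered_stable_subordinator_def)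
  note S0 = subordinator_nonneg[OF sub]
  have lt3: "{..<3::nat} = {0, 1, 2}" by auto
  have ev: "path_events M borel S \<subseteq> events" "path_events M (count_space UNIV) N1 \<subseteq> events"
    "path_events M (count_space UNIV) N2 \<subseteq> events"
    using indep unfolding indep_sets_def lt3 by auto
  have indep3: "prob (A \<inter> B \<inter> C) = prob A * prob B * prob C"
    if "A \<in> path_events M borel S" "B \<in> path_events M (count_space UNIV) N1"
      "C \<in> path_events M (count_space UNIV) N2" for A B C
    using indep_setsD[OF indep, of "{..<3}" "(!) [A, B, C]"] that
    by (simp add: lt3 Int_assoc mult.assoc)
  have N1e: "N1 s -` B \<inter> space M \<in> path_events M (count_space UNIV) N1"
    and N2e: "N2 s -` B \<inter> space M \<in> path_events M (count_space UNIV) N2" if "0 < s" for s B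
    using that by (auto intro!: vimage_in_path_events)
  have N1M: "N1 s \<in> measurable M (count_space UNIV)" and N2M: "N2 s \<in> measurable M (count_space UNIV)"
    if "0 < s" for s
    using N1e[OF that] N2e[OF that] ev by (auto intro!: measurableI)
  have Se: "S t -` A \<inter> space M \<in> path_events M borel S" if "A \<in> sets borel" for A
    using that t by (auto intro!: vimage_in_path_events)
  have paths: "cadlag (\<lambda>t. real (N1 t \<omega>))" "cadlag (\<lambda>t. real (N2 t \<omega>))" if "\<omega> \<in> space M" for \<omega>
    using P1 P2 that by (auto simp: poisson_process_def levy_process_def)
  have Z_eq: "{\<omega> \<in> space M. total_shocks Q t \<omega> = k} = {\<omega> \<in> space M. N1 (S t \<omega>) \<omega> + N2 (S t \<omega>) \<omega> = k}"
    by (simp add: QS total_shocks_def subordinated_pair_def)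
  define p where "p s = ((r1 + r2) * s) ^ k / fact k * exp (- ((r1 + r2) * s))" for s
  have *: "{\<omega> \<in> space M. N1 (S t \<omega>) \<omega> + N2 (S t \<omega>) \<omega> = k} \<in> events \<and>
        prob {\<omega> \<in> space M. N1 (S t \<omega>) \<omega> + N2 (S t \<omega>) \<omega> = k} = expectation (\<lambda>\<omega>. p (S t \<omega>))"
  proof (rule prob_subordinated_count[of "S t" "\<lambda>s \<omega>. N1 s \<omega> + N2 s \<omega>" k p])
    show "S t \<in> borel_measurable M"
      using sub t by (auto simp: levy_subordinator_def levy_process_def)
    show "0 \<le> S t \<omega>" if "\<omega> \<in> space M" for \<omega>
      using S0[OF that t] .
    show "(\<lambda>\<omega>. N1 s \<omega> + N2 s \<omega>) -` {k} \<inter> space M \<in> events" if "0 < s" for s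
    proof -
      note [measurable] = N1M[OF that] N2M[OF that]
      have "(\<lambda>\<omega>. N1 s \<omega> + N2 s \<omega>) \<in> measurable M (count_space UNIV)" by measurable
      then show ?thesis by (rule measurable_sets) simp
    qed
    show "\<forall>\<^sub>F u in at_right (S t \<omega>). N1 u \<omega> + N2 u \<omega> = N1 (S t \<omega>) \<omega> + N2 (S t \<omega>) \<omega>"
      if "\<omega> \<in> space M" for \<omega>
      using cadlag_nat_eventually_const[OF paths(1)[OF that] S0[OF that t]]
        cadlag_nat_eventually_const[OF paths(2)[OF that] S0[OF that t]]
      by eventually_elim simp
    show "\<bar>p s\<bar> \<le> 1" if "0 \<le> s" for s
      unfolding p_def using that r poisson_weight_bounds[of "(r1 + r2) * s" k] by simp
    show "continuous_on {0..} p"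
      unfolding p_def by (intro continuous_intros) auto
    show "prob (S t -` A \<inter> ((\<lambda>\<omega>. N1 s \<omega> + N2 s \<omega>) -` {k}) \<inter> space M) = prob (S t -` A \<inter> space M) * p s"
      if s: "0 < s" and A: "A \<in> sets borel" for s A
    proof -
      \<comment> \<open>The event that the counts total k is split by the value a of the first
        count; on each piece the independence of the three path sigma-algebras applies.\<close>
      let ?E = "\<lambda>a. (S t -` A \<inter> space M) \<inter> (N1 s -` {a} \<inter> space M) \<inter> (N2 s -` {k - a} \<inter> space M)"
      have Ee: "?E a \<in> events" for a
        using Se[OF A] N1e[OF s, of "{a}"] N2e[OF s, of "{k - a}"] ev by blast
      have "S t -` A \<inter> ((\<lambda>\<omega>. N1 s \<omega> + N2 s \<omega>) -` {k}) \<inter> space M = (\<Union>a\<in>{..k}. ?E a)"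
        by auto
      also have "prob \<dots> = (\<Sum>a\<le>k. prob (?E a))"
        using Ee by (intro finite_measure_finite_Union) (auto simp: disjoint_family_on_def)
      also have "\<dots> = (\<Sum>a\<le>k. prob (S t -` A \<inter> space M) *
          (((r1 * s) ^ a / fact a * exp (- (r1 * s))) * ((r2 * s) ^ (k - a) / fact (k - a) * exp (- (r2 * s)))))"
        by (intro sum.cong refl)
          (simp only: indep3[OF Se[OF A] N1e[OF s] N2e[OF s]] poisson_process_prob[OF P1 r(1) s N1M[OF s]]
            poisson_process_prob[OF P2 r(2) s N2M[OF s]] mult.assoc)
      also have "\<dots> = prob (S t -` A \<inter> space M) * p s"
        unfolding sum_distrib_left[symmetric] poisson_weight_convolution p_def by (simp add: distrib_right)
      finally show ?thesis .
    qed
  qed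
  then show "{\<omega> \<in> space M. total_shocks Q t \<omega> = k} \<in> events"
    and "prob {\<omega> \<in> space M. total_shocks Q t \<omega> = k}
       = expectation (\<lambda>\<omega>. ((r1 + r2) * S t \<omega>) ^ k / fact k * exp (- ((r1 + r2) * S t \<omega>)))"
    unfolding Z_eq p_def by blast+
qed

text \<open>Poisson weights lie in [0, 1], so the k-th term is dominated by |s|^k, and sum and
  expectation may be exchanged. Pointwise the exponential series then gives the integrand on the
  right.\<close>

lemma poisson_mixture_generating_function:
  fixes X :: "'a \<Rightarrow> real"
  assumes X: "X \<in> borel_measurable M" "\<And>\<omega>. \<omega> \<in> space M \<Longrightarrow> 0 \<le> X \<omega>" and s: "\<bar>s\<bar> < 1"
  shows "(\<lambda>k. expectation (\<lambda>\<omega>. X \<omega> ^ k / fact k * exp (- X \<omega>)) * s ^ k)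
           sums expectation (\<lambda>\<omega>. exp (- (1 - s) * X \<omega>))"
proof -
  define f where "f k \<omega> = s ^ k * (X \<omega> ^ k / fact k * exp (- X \<omega>))" for k \<omega>
  note [measurable] = X(1)
  have f_le: "\<bar>f k \<omega>\<bar> \<le> \<bar>s\<bar> ^ k" if "\<omega> \<in> space M" for k \<omega>
    unfolding f_def abs_mult[of "s ^ k"] power_abs abs_of_nonneg[OF poisson_weight_bounds(1)[OF X(2)[OF that]]]
    using poisson_weight_bounds(2)[OF X(2)[OF that]] by (rule mult_left_le) simp
  have [measurable]: "f k \<in> borel_measurable M" for k
    unfolding f_def by measurable
  have int: "integrable M (f k)" for k
    using f_le by (intro integrable_const_bound[where B = "\<bar>s\<bar> ^ k"]) auto
  have geo: "summable (\<lambda>k. \<bar>s\<bar> ^ k)" using s by (intro summable_geometric) simp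
  have "(\<lambda>k. expectation (f k)) sums expectation (\<lambda>\<omega>. \<Sum>k. f k \<omega>)"
  proof (rule sums_integral[OF int])
    show "AE \<omega> in M. summable (\<lambda>k. norm (f k \<omega>))"
      using f_le by (intro AE_I2 summable_comparison_test'[OF geo]) auto
    show "summable (\<lambda>k. expectation (\<lambda>\<omega>. norm (f k \<omega>)))"
    proof (rule summable_comparison_test'[OF geo])
      show "norm (expectation (\<lambda>\<omega>. norm (f k \<omega>))) \<le> \<bar>s\<bar> ^ k" for k
      proof -
        have "expectation (\<lambda>\<omega>. norm (f k \<omega>)) \<le> expectation (\<lambda>\<omega>. \<bar>s\<bar> ^ k)"
          using f_le int by (intro integral_mono) auto
        then show ?thesis by (simp add: prob_space)
      qed
    qed
  qed
  also have "expectation (\<lambda>\<omega>. \<Sum>k. f k \<omega>) = expectation (\<lambda>\<omega>. exp (- (1 - s) * X \<omega>))"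
  proof (intro Bochner_Integration.integral_cong refl)
    fix \<omega>
    have "(\<lambda>k. exp (- X \<omega>) * ((s * X \<omega>) ^ k /\<^sub>R fact k)) sums (exp (- X \<omega>) * exp (s * X \<omega>))"
      by (intro sums_mult exp_converges)
    also have "(\<lambda>k. exp (- X \<omega>) * ((s * X \<omega>) ^ k /\<^sub>R fact k)) = (\<lambda>k. f k \<omega>)"
      by (simp add: f_def fun_eq_iff power_mult_distrib field_simps)
    finally show "(\<Sum>k. f k \<omega>) = exp (- (1 - s) * X \<omega>)"
      by (simp add: sums_iff exp_add[symmetric] algebra_simps)
  qed
  also have "(\<lambda>k. expectation (f k)) = (\<lambda>k. expectation (\<lambda>\<omega>. X \<omega> ^ k / fact k * exp (- X \<omega>)) * s ^ k)"
    unfolding f_def by (simp only: integral_mult_right_zero mult.commute)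
  finally show ?thesis .
qed

lemma bivariate_tsfpp_prob:
  assumes Q: "bivariate_tsfpp M \<alpha> \<theta> r1 r2 S N1 N2 Q" and r: "0 < r1" "0 < r2" and t: "0 \<le> t"
    and \<alpha>: "0 < \<alpha>" and \<theta>: "0 < \<theta>"
  shows "prob {\<omega> \<in> space M. total_shocks Q t \<omega> = k}
       = exp (t * \<theta> powr \<alpha>) * ((- (r1 + r2)) ^ k / fact k * stretched_exp_deriv \<alpha> t k (r1 + r2 + \<theta>))"
proof -
  define \<Lambda> where "\<Lambda> = r1 + r2"
  have \<Lambda>: "0 < \<Lambda>" using r by (simp add: \<Lambda>_def)
  have sub: "levy_subordinator M S"
    and lap: "\<And>u. 0 \<le> u \<Longrightarrow> expectation (\<lambda>\<omega>. exp (- u * S t \<omega>)) = exp (- t * ((u + \<theta>) powr \<alpha> - \<theta> powr \<alpha>))"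
    using Q t by (auto simp: bivariate_tsfpp_def tempered_stable_subordinator_def)
  have [measurable]: "S t \<in> borel_measurable M"
    using sub t by (auto simp: levy_subordinator_def levy_process_def)
  define a where "a k = prob {\<omega> \<in> space M. total_shocks Q t \<omega> = k}" for k
  define b where "b k = exp (t * \<theta> powr \<alpha>) * ((- \<Lambda>) ^ k / fact k * stretched_exp_deriv \<alpha> t k (\<Lambda> + \<theta>))" for k
  define g where "g s = exp (- t * ((\<Lambda> * (1 - s) + \<theta>) powr \<alpha> - \<theta> powr \<alpha>))" for s
  have "a k = b k"
  proof (rule power_series_coeff_unique[of 1 a g])
    fix s :: real assume s: "\<bar>s\<bar> < 1"
    have "(\<lambda>k. expectation (\<lambda>\<omega>. (\<Lambda> * S t \<omega>) ^ k / fact k * exp (- (\<Lambda> * S t \<omega>))) * s ^ k)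
           sums expectation (\<lambda>\<omega>. exp (- (1 - s) * (\<Lambda> * S t \<omega>)))"
      using \<Lambda> subordinator_nonneg[OF sub _ t] s by (intro poisson_mixture_generating_function) auto
    \<comment> \<open>The Laplace transform is evaluated at \<Lambda> * (1 - s), which is
      nonnegative for |s| < 1.\<close>
    also have "expectation (\<lambda>\<omega>. exp (- (1 - s) * (\<Lambda> * S t \<omega>))) = g s"
      using lap[of "\<Lambda> * (1 - s)"] s \<Lambda> by (simp add: g_def algebra_simps)
    finally show "(\<lambda>k. a k * s ^ k) sums g s"
      unfolding a_def \<Lambda>_def bivariate_tsfpp_prob_expectation(2)[OF Q r t] .
    \<comment> \<open>The displacement -\<Lambda> s thus stays inside the radius of the expansion
      about \<Lambda> + \<theta> for every s in the unit interval.\<close>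
    have "\<bar>\<Lambda> * s\<bar> < \<Lambda> + \<theta>"
    proof -
      have "\<bar>\<Lambda> * s\<bar> \<le> \<Lambda>" using s \<Lambda> by (simp add: abs_mult mult_left_le)
      then show ?thesis using \<theta> by simp
    qed
    then have "(\<lambda>i. exp (t * \<theta> powr \<alpha>) * (stretched_exp_deriv \<alpha> t (0 + i) (\<Lambda> + \<theta>) / fact i * (- (\<Lambda> * s)) ^ i))
        sums (exp (t * \<theta> powr \<alpha>) * stretched_exp_deriv \<alpha> t 0 (\<Lambda> + \<theta> + - (\<Lambda> * s)))"
      by (intro sums_mult stretched_exp_taylor[OF \<alpha>]) simp
    moreover have "exp (t * \<theta> powr \<alpha>) * stretched_exp_deriv \<alpha> t 0 (\<Lambda> + \<theta> + - (\<Lambda> * s)) = g s"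
      using \<open>\<bar>\<Lambda> * s\<bar> < \<Lambda> + \<theta>\<close>
      by (simp add: stretched_exp_deriv_0 g_def exp_add[symmetric] algebra_simps)
    moreover have "(- (\<Lambda> * s)) ^ i = (- \<Lambda>) ^ i * s ^ i" for i
      by (simp flip: power_mult_distrib)
    ultimately show "(\<lambda>k. b k * s ^ k) sums g s"
      by (simp add: b_def mult_ac)
  qed simp
  then show ?thesis by (simp add: a_def b_def \<Lambda>_def)
qed

section \<open>The reliability function as a series over the number of shocks\<close>

lemma reliability_sums:
  assumes Q: "bivariate_tsfpp M \<alpha> \<theta> r1 r2 S N1 N2 Q" and r: "0 < r1" "0 < r2" and t: "0 \<le> t"
    and L: "L \<in> measurable M (count_space UNIV)"
    and indep: "indep_set (sets (vimage_algebra (space M) L (count_space UNIV)))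
           (path_events M (count_space UNIV) Q)"
  shows "(\<lambda>k. prob {\<omega> \<in> space M. L \<omega> > k} * prob {\<omega> \<in> space M. total_shocks Q t \<omega> = k})
           sums reliability M (failure_time Q L) t"
proof -
  let ?L = "\<lambda>k. {\<omega> \<in> space M. L \<omega> > k}" and ?Z = "\<lambda>k. {\<omega> \<in> space M. total_shocks Q t \<omega> = k}"
  \<comment> \<open>Survival beyond t means that the total count at t is below L. Splitting by the
    value k of that count gives disjoint events, each a product event for L and Q.\<close>
  have "{\<omega> \<in> space M. failure_time Q L \<omega> > ereal t} = {\<omega> \<in> space M. total_shocks Q t \<omega> < L \<omega>}"
    unfolding failure_time_def
    using Inf_reaching_times_gt_iff[OF bivariate_tsfpp_paths[OF Q] t] t by auto
  also have "\<dots> = (\<Union>k. ?L k \<inter> ?Z k)" by auto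
  finally have eq: "reliability M (failure_time Q L) t = prob (\<Union>k. ?L k \<inter> ?Z k)"
    by (simp add: reliability_def)
  have Le: "?L k \<in> sets (vimage_algebra (space M) L (count_space UNIV))" for k
  proof -
    have "?L k = L -` {k<..} \<inter> space M" by auto
    then show ?thesis by (simp add: in_vimage_algebra)
  qed
  have Ze: "?Z k \<in> path_events M (count_space UNIV) Q" for k
  proof -
    have "?Z k = Q t -` {p. fst p + snd p = k} \<inter> space M" by (auto simp: total_shocks_def)
    moreover have "Q t -` {p. fst p + snd p = k} \<inter> space M \<in> path_events M (count_space UNIV) Q"
      by (rule vimage_in_path_events[OF t]) simp_all
    ultimately show ?thesis by (simp only:)
  qed
  have LZ: "?L k \<inter> ?Z k \<in> events" for k
    using Le[of k] Ze[of k] indep_setD_ev1[OF indep] indep_setD_ev2[OF indep] by (intro sets.Int) auto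
  have "(\<lambda>k. prob (?L k \<inter> ?Z k)) sums prob (\<Union>k. ?L k \<inter> ?Z k)"
    using LZ by (intro finite_measure_UNION) (auto simp: disjoint_family_on_def)
  then show ?thesis
    unfolding eq by (simp only: indep_setD[OF indep Le Ze])
qed

end

text \<open>For \<theta> > \<Lambda> and t > 0 the inner series with k = 0 diverges by
  \<open>not_summable_stretched_exp_taylor\<close>. The formula is therefore asserted whenever all
  inner series converge, and their convergence is a separate claim for \<theta> < \<Lambda>.\<close>

theorem proposition4p3:
  fixes M :: "'a measure"
    and \<alpha> \<theta> rate1 rate2 \<Lambda> t :: real
    and S :: "real \<Rightarrow> 'a \<Rightarrow> real"
    and N1 N2 :: "real \<Rightarrow> 'a \<Rightarrow> nat"
    and Q :: "real \<Rightarrow> 'a \<Rightarrow> nat \<times> nat"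
    and L :: "'a \<Rightarrow> nat"
    and q :: "nat \<Rightarrow> real"
    and T :: "'a \<Rightarrow> ereal"
  assumes "prob_space M"
    and "0 < \<alpha>" and "\<alpha> < 1" and "0 < \<theta>" and "0 < rate1" and "0 < rate2"
    and "\<Lambda> = rate1 + rate2"
    and "bivariate_tsfpp M \<alpha> \<theta> rate1 rate2 S N1 N2 Q"
    and "L \<in> measurable M (count_space UNIV)"
    and "\<forall>\<omega>\<in>space M. 1 \<le> L \<omega>"
    and "\<forall>k. q k = measure M {\<omega> \<in> space M. L \<omega> > k}"
    and "prob_space.indep_set M
           (sets (vimage_algebra (space M) L (count_space UNIV)))
           (path_events M (count_space UNIV) Q)"
    and "T = failure_time Q L"
    and "0 \<le> t"
  shows
    "(\<theta> < \<Lambda> \<longrightarrow>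
        (\<forall>k::nat. summable (\<lambda>i::nat. \<theta> ^ i / (\<Lambda> ^ i * fact i) *
           wright_psi11 1 \<alpha> (1 - real k - real i) \<alpha> (- (\<Lambda> powr \<alpha>) * t)))) \<and>
     ((\<forall>k::nat. summable (\<lambda>i::nat. \<theta> ^ i / (\<Lambda> ^ i * fact i) *
           wright_psi11 1 \<alpha> (1 - real k - real i) \<alpha> (- (\<Lambda> powr \<alpha>) * t))) \<longrightarrow>
        (\<lambda>k::nat. q k * ((- 1) ^ k / fact k * exp (t * \<theta> powr \<alpha>) *
           (\<Sum>i::nat. \<theta> ^ i / (\<Lambda> ^ i * fact i) *
              wright_psi11 1 \<alpha> (1 - real k - real i) \<alpha> (- (\<Lambda> powr \<alpha>) * t))))
          sums reliability M T t)"
proof -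
  interpret prob_space M by fact
  have \<Lambda>: "0 < \<Lambda>" using assms by simp
  define w where "w k i = \<theta> ^ i / (\<Lambda> ^ i * fact i) *
      wright_psi11 1 \<alpha> (1 - real k - real i) \<alpha> (- (\<Lambda> powr \<alpha>) * t)" for k i
  define d where "d k i = stretched_exp_deriv \<alpha> t (k + i) \<Lambda> / fact i * \<theta> ^ i" for k i
  \<comment> \<open>The Wright function contributes \<open>\<Lambda> ^ (k + i)\<close>, whose part
    \<open>\<Lambda> ^ i\<close> cancels against the denominator.\<close>
  have w: "w k = (\<lambda>i. \<Lambda> ^ k * d k i)" for k
    unfolding w_def d_def wright_psi11_eq_stretched_exp_deriv[OF \<open>0 < \<alpha>\<close> \<Lambda>]
    using \<Lambda> by (simp add: fun_eq_iff power_add)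
  have sm_iff: "summable (w k) \<longleftrightarrow> summable (d k)" for k
    unfolding w using \<Lambda> by (subst summable_cmult_iff) simp
  have "summable (w k)" if "\<theta> < \<Lambda>" for k
    unfolding sm_iff d_def
    by (rule sums_summable[OF stretched_exp_taylor]) (use assms that in auto)
  moreover have "(\<lambda>k. q k * ((- 1) ^ k / fact k * exp (t * \<theta> powr \<alpha>) * (\<Sum>i. w k i))) sums reliability M T t"
    if sm: "\<And>k. summable (w k)"
  proof -
    have "(\<Sum>i. w k i) = \<Lambda> ^ k * stretched_exp_deriv \<alpha> t k (\<Lambda> + \<theta>)" for k
    proof -
      have "d k sums stretched_exp_deriv \<alpha> t k (\<Lambda> + \<theta>)"
        unfolding d_def
        by (rule stretched_exp_taylor_summable) (use assms \<Lambda> sm[unfolded sm_iff d_def] in auto)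
      then show ?thesis
        unfolding w by (simp add: suminf_mult sums_iff)
    qed
    \<comment> \<open>The signs and the factor \<open>\<Lambda> ^ k\<close> combine to
      \<open>(- \<Lambda>) ^ k\<close>, as in the mass function of the total count.\<close>
    then have "(- 1) ^ k / fact k * exp (t * \<theta> powr \<alpha>) * (\<Sum>i. w k i)
        = prob {\<omega> \<in> space M. total_shocks Q t \<omega> = k}" for k
      using bivariate_tsfpp_prob[of \<alpha> \<theta> rate1 rate2 S N1 N2 Q t k, unfolded power_minus[of "rate1 + rate2"]] assms
      by simp
    then show ?thesis
      using reliability_sums[of \<alpha> \<theta> rate1 rate2 S N1 N2 Q t L] assms by simp
  qed
  ultimately show ?thesis
    unfolding w_def by (intro conjI impI allI) simp_all
qed

end
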